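(* Let $\mathbb{I}\in\{\mathbb{Q},\mathbb{R}\}$, $N\ge 1$, and let $\mathbf{m}^+,\mathbf{n}^+$ be coherent $2N\times 2N$ DBMs over $\overline{\mathbb{I}}=\mathbb{I}\cup\{+\infty\}$ with $\mathcal{D}^+(\mathbf{m}^+)\neq\emptyset$ and $\mathcal{D}^+(\mathbf{n}^+)\neq\emptyset$. Then: 1. $\mathcal{D}^+(\mathbf{m}^+)\subseteq\mathcal{D}^+(\mathbf{n}^+)$ if and only if $(\mathbf{m}^+)^\bullet\trianglelefteq\mathbf{n}^+$; 2. $\mathcal{D}^+(\mathbf{m}^+)=\mathcal{D}^+(\mathbf{n}^+)$ if and only if $(\mathbf{m}^+)^\bullet=(\mathbf{n}^+)^\bullet$.
   Context: A Difference-Bound Matrix (DBM) is a square matrix with entries in $\overline{\mathbb{I}}=\mathbb{I}\cup\{+\infty\}$, indexed from $0$. The order $\trianglelefteq$ on DBMs of the same size is point-wise: $\mathbf{m}\trianglelefteq\mathbf{n}$ iff $\mathbf{m}_{ij}\le\mathbf{n}_{ij}$ for all $i,j$. For an index $i\in\{0,\ldots,2N-1\}$, $\bar{\imath}$ denotes $i\oplus 1$ (bitwise exclusive or), i.e. $\overline{2k}=2k+1$ and $\overline{2k+1}=2k$. A $2N\times 2N$ DBM $\mathbf{m}^+$ is coherent if $\mathbf{m}^+_{ij}=\mathbf{m}^+_{\bar{\jmath}\,\bar{\imath}}$ for all $i,j$. $\mathcal{D}(\mathbf{m}^+)=\{(s_0,\ldots,s_{2N-1})\in\mathbb{I}^{2N}\mid\forall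 i,j,\ s_j-s_i\le\mathbf{m}^+_{ij}\}$ and $\mathcal{D}^+(\mathbf{m}^+)=\{(s_0,\ldots,s_{N-1})\in\mathbb{I}^N\mid (s_0,-s_0,\ldots,s_{N-1},-s_{N-1})\in\mathcal{D}(\mathbf{m}^+)\}$. The strong closure $(\mathbf{m}^+)^\bullet$ is the output of the following algorithm: $\mathbf{m}^+_0=\mathbf{m}^+$, $\mathbf{m}^+_{k+1}=S^+(C^+_{2k}(\mathbf{m}^+_k))$ for $0\le k<N$, and $(\mathbf{m}^+)^\bullet=\mathbf{m}^+_N$, where $[C^+_k(\mathbf{n})]_{ii}=0$; for $i\ne j$, $$[C^+_k(\mathbf{n})]_{ij}=\min\big(\mathbf{n}_{ij},\ \mathbf{n}_{ik}+\mathbf{n}_{kj},\ \mathbf{n}_{i\bar{k}}+\mathbf{n}_{\bar{k}j},\ \mathbf{n}_{ik}+\mathbf{n}_{k\bar{k}}+\mathbf{n}_{\bar{k}j},\ \mathbf{n}_{i\bar{k}}+\mathbf{n}_{\bar{k}k}+\mathbf{n}_{kj}\big);$$ and $[S^+(\mathbf{n})]_{ij}=\min\big(\mathbf{n}_{ij},\ (\mathbf{n}_{i\bar{\imath}}+\mathbf{n}_{\bar{\jmath}j})/2\big)$ for all $i,j$. *)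

theory Defs
  imports Jordan_Normal_Form.Matrix "HOL-Library.Extended_Real"
begin

text \<open>
  The scalar domain is a set \<open>I\<close> of reals (the rationals or all the reals). Difference-bound
  matrices are matrices of extended reals whose entries lie in \<open>I \<union> {\<infinity>}\<close>, so that \<open>-\<infinity>\<close> is
  excluded. The library order \<open>\<le>\<close> on matrices of equal dimensions is the point-wise one
  (\<open>less_eq_mat_def\<close>).
\<close>

definition dbm :: "real set \<Rightarrow> nat \<Rightarrow> ereal mat \<Rightarrow> bool" where
  "dbm I n m \<longleftrightarrow> m \<in> carrier_mat n n \<and>
     (\<forall>i<n. \<forall>j<n. m $$ (i, j) \<in> ereal ` I \<union> {\<infinity>})"

definition bar :: "nat \<Rightarrow> nat" where
  "bar i = semiring_bit_operations_class.xor i 1"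

lemma bar_even: "bar (2 * k) = 2 * k + 1"
  and bar_odd: "bar (2 * k + 1) = 2 * k"
  by (simp_all add: bar_def xor_one_eq del: One_nat_def)

definition coherent :: "ereal mat \<Rightarrow> bool" where
  "coherent m \<longleftrightarrow> (\<forall>i<dim_row m. \<forall>j<dim_col m. m $$ (i, j) = m $$ (bar j, bar i))"

definition dbm_domain :: "real set \<Rightarrow> ereal mat \<Rightarrow> real vec set" where
  "dbm_domain I m = {s \<in> carrier_vec (dim_row m).
     (\<forall>i<dim_row m. s $ i \<in> I) \<and>
     (\<forall>i<dim_row m. \<forall>j<dim_row m. ereal (s $ j - s $ i) \<le> m $$ (i, j))}"

text \<open>The vector \<open>(s\<^sub>0, - s\<^sub>0, s\<^sub>1, - s\<^sub>1, \<dots>)\<close>.\<close>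

definition signed_vec :: "real vec \<Rightarrow> real vec" where
  "signed_vec s = vec (2 * dim_vec s)
     (\<lambda>i. if even i then s $ (i div 2) else - (s $ (i div 2)))"

definition oct_domain :: "real set \<Rightarrow> ereal mat \<Rightarrow> real vec set" where
  "oct_domain I m = {s \<in> carrier_vec (dim_row m div 2).
     (\<forall>i<dim_row m div 2. s $ i \<in> I) \<and> signed_vec s \<in> dbm_domain I m}"

definition C_step :: "nat \<Rightarrow> ereal mat \<Rightarrow> ereal mat" where
  "C_step k n = mat (dim_row n) (dim_col n) (\<lambda>(i, j).
     if i = j then 0
     else Min {n $$ (i, j),
               n $$ (i, k) + n $$ (k, j),
               n $$ (i, bar k) + n $$ (bar k, j),
               n $$ (i, k) + n $$ (k, bar k) + n $$ (bar k, j),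
               n $$ (i, bar k) + n $$ (bar k, k) + n $$ (k, j)})"

definition S_step :: "ereal mat \<Rightarrow> ereal mat" where
  "S_step n = mat (dim_row n) (dim_col n) (\<lambda>(i, j).
     min (n $$ (i, j)) ((n $$ (i, bar i) + n $$ (bar j, j)) / 2))"

primrec strong_closure_iter :: "ereal mat \<Rightarrow> nat \<Rightarrow> ereal mat" where
  "strong_closure_iter m 0 = m"
| "strong_closure_iter m (Suc k) = S_step (C_step (2 * k) (strong_closure_iter m k))"

definition strong_closure :: "ereal mat \<Rightarrow> ereal mat" where
  "strong_closure m = strong_closure_iter m (dim_row m div 2)"

end

theory Submission
  imports Defs
begin

text \<open>
  A point of the domain rules out negative cycles. Under this hypothesis a step \<open>C_step k\<close> is, off the
  diagonal, two Floyd--Warshall steps, so it preserves the triangle inequality through all pivots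
  processed before and establishes it for \<open>k\<close> and \<open>bar k\<close>; \<open>S_step\<close> preserves the triangle
  inequalities through \<open>p\<close> when they hold through both \<open>p\<close> and \<open>bar p\<close>. Hence the strong closure is
  closed for all pivots, it has the same domain, and the last \<open>S_step\<close> makes it strong.

  For such a matrix every bound is attained. Strength yields values of two variables that satisfy the
  constraints among them with the prescribed difference. The triangle inequalities
  (Fourier--Motzkin elimination) then allow to extend the solution by one variable at a time, with
  values in \<open>I\<close> because all bounds on the new variable are in \<open>I\<close>. So the strong closure is the least
  matrix with the given domain.
\<close>

section \<open>The pairing of indices by \<open>bar\<close>\<close>

lemma bar_bar [simp]: "bar (bar i) = i"
  and bar_neq [simp]: "bar i \<noteq> i" "i \<noteq> bar i"
  and even_bar [simp]: "even (bar i) \<longleftrightarrow> odd i"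
  and bar_div_2 [simp]: "bar i div 2 = i div 2"
  and bar_less [simp]: "bar i < 2 * N \<longleftrightarrow> i < 2 * N"
  by (cases "even i"; force elim!: evenE oddE simp: bar_even bar_odd[simplified])+

lemma bar_eq_iff [simp]: "bar i = bar j \<longleftrightarrow> i = j"
  by (metis bar_bar)

lemma bar_swap: "bar i = j \<longleftrightarrow> i = bar j"
  by (metis bar_bar)

subsection \<open>Feasible points\<close>

text \<open>The sign condition holds at all indices, the inequalities only inside \<open>V\<close>:
  a solution for part of the variables is thus a total function that can be updated later.
  Membership in \<open>I\<close> is tracked separately.\<close>

definition feasible :: "nat set \<Rightarrow> ereal mat \<Rightarrow> (nat \<Rightarrow> real) \<Rightarrow> bool" where
  "feasible V m s \<longleftrightarrow> (\<forall>i. s (bar i) = - s i) \<and>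
     (\<forall>i\<in>V. \<forall>j\<in>V. ereal (s j - s i) \<le> m $$ (i, j))"

definition signed :: "real vec \<Rightarrow> nat \<Rightarrow> real" where
  "signed v i = (if even i then v $ (i div 2) else - (v $ (i div 2)))"

lemma signed_bar: "signed v (bar i) = - signed v i"
  by (simp add: signed_def)

text \<open>Closure properties shared by the rationals and the reals. Halving serves
  \<open>S_step\<close> and the bounds on twice a variable; the element \<open>1\<close> yields
  arbitrarily large scalars.\<close>

locale scalar_set =
  fixes I :: "real set"
  assumes one_mem: "1 \<in> I"
    and add_mem: "x \<in> I \<Longrightarrow> y \<in> I \<Longrightarrow> x + y \<in> I"
    and uminus_mem: "x \<in> I \<Longrightarrow> - x \<in> I"
    and half_mem: "x \<in> I \<Longrightarrow> x / 2 \<in> I"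
begin

lemma zero_mem: "0 \<in> I"
  using add_mem[OF one_mem uminus_mem[OF one_mem]] by simp

lemma of_nat_mem: "of_nat k \<in> I"
  by (induction k) (simp_all add: zero_mem one_mem add_mem)

end

lemma (in scalar_set) oct_domain_iff:
  assumes m: "dim_row m = 2 * N"
  shows "v \<in> oct_domain I m \<longleftrightarrow>
    v \<in> carrier_vec N \<and> (\<forall>i<N. v $ i \<in> I) \<and> feasible {..<2 * N} m (signed v)"
proof -
  have "signed_vec v \<in> dbm_domain I m \<longleftrightarrow> feasible {..<2 * N} m (signed v)"
    if v: "v \<in> carrier_vec N" "\<forall>i<N. v $ i \<in> I"
  proof -
    have "signed_vec v $ i = signed v i" if "i < 2 * N" for i
      using v(1) that by (simp add: signed_vec_def signed_def)
    moreover have "signed v i \<in> I" if "i < 2 * N" for i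
      using v(2) uminus_mem that by (simp add: signed_def less_mult_imp_div_less mult.commute)
    moreover have "signed_vec v \<in> carrier_vec (2 * N)"
      using carrier_vecD[OF v(1)] by (intro carrier_vecI) (simp add: signed_vec_def)
    ultimately show ?thesis
      by (simp add: dbm_domain_def feasible_def m signed_bar Ball_def)
  qed
  then show ?thesis
    unfolding oct_domain_def m by auto
qed

subsection \<open>One step of the closure algorithm\<close>

text \<open>The triangle inequality is stated for a single intermediate index because the algorithm
  establishes it pivot by pivot.\<close>

definition closed_at :: "ereal mat \<Rightarrow> nat \<Rightarrow> bool" where
  "closed_at m p \<longleftrightarrow>
     (\<forall>i<dim_row m. \<forall>j<dim_row m. m $$ (i, j) \<le> m $$ (i, p) + m $$ (p, j))"

section \<open>Extended reals compared through their finite upper bounds\<close>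

lemma ereal_add_le_iff:
  fixes x y :: ereal
  assumes "x \<noteq> -\<infinity>" "y \<noteq> -\<infinity>"
  shows "x + y \<le> ereal c \<longleftrightarrow> (\<exists>a b. x \<le> ereal a \<and> y \<le> ereal b \<and> a + b \<le> c)"
  using assms by (cases x; cases y) (auto intro: add_mono order_trans)

lemma ereal_half_le_iff: "x / ereal 2 \<le> ereal c \<longleftrightarrow> x \<le> ereal (2 * c)"
  by (cases x) (auto simp: field_simps)

text \<open>Comparing real upper bounds turns goals about \<open>ereal\<close> into linear
  arithmetic over the reals: the value \<infinity> has no such bound, and -\<infinity> is the only
  value below every real.\<close>

lemma ereal_le_by_bounds:
  fixes x y :: ereal
  assumes "\<And>c. y \<le> ereal c \<Longrightarrow> x \<le> ereal c"
  shows "x \<le> y"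
  using assms by (cases y) (auto intro: ereal_bot)

lemma closed_atD:
  assumes "closed_at m p" "i < dim_row m" "j < dim_row m"
    and "m $$ (i, p) \<le> ereal a" "m $$ (p, j) \<le> ereal b"
  shows "m $$ (i, j) \<le> ereal (a + b)"
  using assms add_mono[of "m $$ (i, p)" "ereal a" "m $$ (p, j)" "ereal b"]
  by (auto simp: closed_at_def intro: order_trans)

lemma closed_atI:
  assumes "\<And>i j. i < dim_row m \<Longrightarrow> j < dim_row m \<Longrightarrow> m $$ (i, j) \<noteq> -\<infinity>" "p < dim_row m"
    and "\<And>i j a b. i < dim_row m \<Longrightarrow> j < dim_row m \<Longrightarrow>
      m $$ (i, p) \<le> ereal a \<Longrightarrow> m $$ (p, j) \<le> ereal b \<Longrightarrow> m $$ (i, j) \<le> ereal (a + b)"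
  shows "closed_at m p"
  unfolding closed_at_def
proof (intro allI impI, rule ereal_le_by_bounds)
  fix i j c assume *: "i < dim_row m" "j < dim_row m" "m $$ (i, p) + m $$ (p, j) \<le> ereal c"
  then obtain a b where "m $$ (i, p) \<le> ereal a" "m $$ (p, j) \<le> ereal b" "a + b \<le> c"
    using ereal_add_le_iff assms(1,2) by meson
  with assms(3) * show "m $$ (i, j) \<le> ereal c"
    by (meson ereal_less_eq(3) order_trans)
qed

lemma dbm_not_MInf:
  assumes "dbm I n m" "i < n" "j < n"
  shows "m $$ (i, j) \<noteq> -\<infinity>"
  using assms by (fastforce simp: dbm_def)

lemma dim_C_step [simp]: "dim_row (C_step k m) = dim_row m" "dim_col (C_step k m) = dim_col m"
  by (simp_all add: C_step_def)

lemma dim_S_step [simp]: "dim_row (S_step m) = dim_row m" "dim_col (S_step m) = dim_col m"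
  by (simp_all add: S_step_def)

text \<open>A minimum is at most \<open>c\<close> iff one of its arguments is. Off the diagonal a
  bound therefore amounts to a path from \<open>i\<close> to \<open>j\<close> through some of
  \<open>k\<close> and \<open>bar k\<close>, with one real bound per edge.\<close>

lemma C_step_le_iff:
  assumes m: "dbm I (2 * N) m" and i: "i < 2 * N" and j: "j < 2 * N" and k: "k < 2 * N"
  shows "C_step k m $$ (i, j) \<le> ereal c \<longleftrightarrow>
    (if i = j then 0 \<le> c
     else m $$ (i, j) \<le> ereal c \<or>
       (\<exists>a b. m $$ (i, k) \<le> ereal a \<and> m $$ (k, j) \<le> ereal b \<and> a + b \<le> c) \<or>
       (\<exists>a b. m $$ (i, bar k) \<le> ereal a \<and> m $$ (bar k, j) \<le> ereal b \<and> a + b \<le> c) \<or>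
       (\<exists>a d b. m $$ (i, k) \<le> ereal a \<and> m $$ (k, bar k) \<le> ereal d \<and>
          m $$ (bar k, j) \<le> ereal b \<and> a + d + b \<le> c) \<or>
       (\<exists>a d b. m $$ (i, bar k) \<le> ereal a \<and> m $$ (bar k, k) \<le> ereal d \<and>
          m $$ (k, j) \<le> ereal b \<and> a + d + b \<le> c))"
proof -
  have add2: "x + y \<le> ereal c \<longleftrightarrow> (\<exists>a b. x \<le> ereal a \<and> y \<le> ereal b \<and> a + b \<le> c)"
    if "x \<noteq> -\<infinity>" "y \<noteq> -\<infinity>" for x y :: ereal
    using ereal_add_le_iff that .
  have add3: "x + y + z \<le> ereal c \<longleftrightarrow>
      (\<exists>a d b. x \<le> ereal a \<and> y \<le> ereal d \<and> z \<le> ereal b \<and> a + d + b \<le> c)"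
    if "x \<noteq> -\<infinity>" "y \<noteq> -\<infinity>" "z \<noteq> -\<infinity>" for x y z :: ereal
    using that by (cases x; cases y; cases z) (auto intro: add_mono order_trans)
  have "dim_row m = 2 * N" "dim_col m = 2 * N"
    using m by (auto simp: dbm_def)
  then show ?thesis
    using i j k dbm_not_MInf[OF m]
    \<comment> \<open>The three-term sums are split first, since \<open>add2\<close> would match
      them as well.\<close>
    by (simp add: C_step_def min_le_iff_disj add3) (simp add: add2)
qed

lemma S_step_le_iff:
  assumes m: "dbm I (2 * N) m" and i: "i < 2 * N" and j: "j < 2 * N"
  shows "S_step m $$ (i, j) \<le> ereal c \<longleftrightarrow> m $$ (i, j) \<le> ereal c \<or>
    (\<exists>a b. m $$ (i, bar i) \<le> ereal a \<and> m $$ (bar j, j) \<le> ereal b \<and> a + b \<le> 2 * c)"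
proof -
  have "dim_row m = 2 * N" "dim_col m = 2 * N"
    using m by (auto simp: dbm_def)
  then show ?thesis
    using i j dbm_not_MInf[OF m]
    by (simp add: S_step_def min_le_iff_disj ereal_half_le_iff ereal_add_le_iff)
qed

section \<open>Effect of the steps on feasible points\<close>

lemma feasible_bound:
  assumes "feasible V m s" "m $$ (i, j) \<le> ereal c" "i \<in> V" "j \<in> V"
  shows "s j - s i \<le> c"
  using assms unfolding feasible_def by (metis ereal_less_eq(3) order_trans)

lemma feasibleI:
  assumes "\<And>i. s (bar i) = - s i"
    and "\<And>i j c. i \<in> V \<Longrightarrow> j \<in> V \<Longrightarrow> m $$ (i, j) \<le> ereal c \<Longrightarrow> s j - s i \<le> c"
  shows "feasible V m s"
  unfolding feasible_def
proof (intro conjI allI ballI, rule assms(1), rule ereal_le_by_bounds)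
  fix i j c
  assume "i \<in> V" "j \<in> V" "m $$ (i, j) \<le> ereal c"
  then show "ereal (s j - s i) \<le> ereal c"
    using assms(2) by simp
qed

lemma feasible_bar: "feasible V m s \<Longrightarrow> s (bar i) = - s i"
  by (simp add: feasible_def)

text \<open>Each candidate off the diagonal is the length of a path, and the constraints along a
  path telescope to one on \<open>s j - s i\<close>.\<close>

lemma feasible_C_step:
  assumes m: "dbm I (2 * N) m" and k: "k < 2 * N" and s: "feasible {..<2 * N} m s"
  shows "feasible {..<2 * N} (C_step k m) s"
proof (rule feasibleI)
  fix i j c
  assume *: "i \<in> {..<2 * N}" "j \<in> {..<2 * N}" "C_step k m $$ (i, j) \<le> ereal c"
  have b: "s j - s i \<le> c" if "m $$ (i, j) \<le> ereal c" "i < 2 * N" "j < 2 * N" for i j c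
    using feasible_bound[OF s that(1)] that(2,3) by simp
  have k': "bar k < 2 * N"
    using k by simp
  have ij: "i < 2 * N" "j < 2 * N"
    using * by auto
  note bounds = b[OF _ ij] b[OF _ ij(1) k] b[OF _ k ij(2)] b[OF _ ij(1) k'] b[OF _ k' ij(2)]
    b[OF _ k k'] b[OF _ k' k]
  show "s j - s i \<le> c"
    using *(3) unfolding C_step_le_iff[OF m ij k] by (auto split: if_splits dest!: bounds)
qed (rule feasible_bar[OF s])

text \<open>By the sign condition the entries at \<open>(i, bar i)\<close> and
  \<open>(bar j, j)\<close> bound \<open>- 2 * s i\<close> and \<open>2 * s j\<close>; their average
  bounds \<open>s j - s i\<close>.\<close>

lemma feasible_S_step:
  assumes m: "dbm I (2 * N) m" and s: "feasible {..<2 * N} m s"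
  shows "feasible {..<2 * N} (S_step m) s"
proof (rule feasibleI)
  fix i j c
  assume *: "i \<in> {..<2 * N}" "j \<in> {..<2 * N}" "S_step m $$ (i, j) \<le> ereal c"
  then have ij: "i < 2 * N" "j < 2 * N"
    by auto
  have "s j - s i \<le> c" if "m $$ (i, j) \<le> ereal c"
    using feasible_bound[OF s that] ij by simp
  moreover have "- 2 * s i \<le> a" if "m $$ (i, bar i) \<le> ereal a" for a
    using feasible_bound[OF s that] ij feasible_bar[OF s, of i] by simp
  moreover have "2 * s j \<le> a" if "m $$ (bar j, j) \<le> ereal a" for a
    using feasible_bound[OF s that] ij feasible_bar[OF s, of j] by simp
  ultimately show "s j - s i \<le> c"
    using *(3) unfolding S_step_le_iff[OF m ij] by fastforce
qed (rule feasible_bar[OF s])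

text \<open>The point \<open>t\<close> serves to exclude negative diagonal entries, which the algorithm overwrites.\<close>

lemma feasible_C_step_iff:
  assumes m: "dbm I (2 * N) m" and k: "k < 2 * N" and t: "feasible {..<2 * N} m t"
  shows "feasible {..<2 * N} (C_step k m) s \<longleftrightarrow> feasible {..<2 * N} m s"
proof
  assume s: "feasible {..<2 * N} (C_step k m) s"
  show "feasible {..<2 * N} m s"
  proof (rule feasibleI)
    fix i j c
    assume *: "i \<in> {..<2 * N}" "j \<in> {..<2 * N}" "m $$ (i, j) \<le> ereal c"
    then have "0 \<le> c" if "i = j"
      using feasible_bound[OF t] that by fastforce
    then have "C_step k m $$ (i, j) \<le> ereal c"
      using * by (simp add: C_step_le_iff[OF m _ _ k])
    then show "s j - s i \<le> c"
      using feasible_bound[OF s] * by blast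
  qed (rule feasible_bar[OF s])
qed (rule feasible_C_step[OF m k])

lemma feasible_S_step_iff:
  assumes m: "dbm I (2 * N) m"
  shows "feasible {..<2 * N} (S_step m) s \<longleftrightarrow> feasible {..<2 * N} m s"
proof
  assume s: "feasible {..<2 * N} (S_step m) s"
  show "feasible {..<2 * N} m s"
  proof (rule feasibleI)
    fix i j c
    assume *: "i \<in> {..<2 * N}" "j \<in> {..<2 * N}" "m $$ (i, j) \<le> ereal c"
    then have "S_step m $$ (i, j) \<le> ereal c"
      by (simp add: S_step_le_iff[OF m])
    then show "s j - s i \<le> c"
      using feasible_bound[OF s] * by blast
  qed (rule feasible_bar[OF s])
qed (rule feasible_S_step[OF m])

section \<open>Preservation of coherence and of the scalar domain\<close>

lemma coherentD:
  assumes "coherent m" "m \<in> carrier_mat (2 * N) (2 * N)" "i < 2 * N" "j < 2 * N"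
  shows "m $$ (i, j) = m $$ (bar j, bar i)"
  using assms(1,3,4) carrier_matD[OF assms(2)] unfolding coherent_def by metis

text \<open>Reversing a path and barring its indices keeps its length. This exchanges the two
  candidates with one intermediate index and maps each of the two longer ones to its own
  shape.\<close>

lemma coherent_C_step:
  assumes m: "coherent m" "m \<in> carrier_mat (2 * N) (2 * N)" and k: "k < 2 * N"
  shows "coherent (C_step k m)"
proof -
  have dim: "dim_row m = 2 * N" "dim_col m = 2 * N"
    using m by auto
  have "C_step k m $$ (i, j) = C_step k m $$ (bar j, bar i)" if "i < 2 * N" "j < 2 * N" for i j
  proof -
    note c = coherentD[OF m, unfolded bar_less]
    have "m $$ (i, j) = m $$ (bar j, bar i)" "m $$ (i, k) = m $$ (bar k, bar i)"
      "m $$ (k, j) = m $$ (bar j, bar k)" "m $$ (i, bar k) = m $$ (k, bar i)"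
      "m $$ (bar k, j) = m $$ (bar j, k)"
      using that k c[of i j] c[of i k] c[of k j] c[of i "bar k"] c[of "bar k" j] by simp_all
    then show ?thesis
      using that by (simp add: C_step_def dim) (simp add: ac_simps)
  qed
  then show ?thesis
    unfolding coherent_def dim_C_step dim by blast
qed

lemma coherent_S_step:
  assumes m: "coherent m" "m \<in> carrier_mat (2 * N) (2 * N)"
  shows "coherent (S_step m)"
proof -
  have dim: "dim_row m = 2 * N" "dim_col m = 2 * N"
    using m by auto
  have "S_step m $$ (i, j) = S_step m $$ (bar j, bar i)" if "i < 2 * N" "j < 2 * N" for i j
    using that by (simp add: S_step_def dim coherentD[OF m that] add.commute)
  then show ?thesis
    unfolding coherent_def dim_S_step dim by blast
qed

lemma (in scalar_set) dbm_C_step: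
  assumes m: "dbm I (2 * N) m" and k: "k < 2 * N"
  shows "dbm I (2 * N) (C_step k m)"
proof -
  let ?J = "ereal ` I \<union> {\<infinity>}"
  have dim: "dim_row m = 2 * N" "dim_col m = 2 * N"
    using m by (auto simp: dbm_def)
  have J: "m $$ (i, j) \<in> ?J" if "i < 2 * N" "j < 2 * N" for i j
    using m that by (auto simp: dbm_def)
  have add: "x + y \<in> ?J" if "x \<in> ?J" "y \<in> ?J" for x y
    using that add_mem by auto
  have "C_step k m $$ (i, j) \<in> ?J" if "i < 2 * N" "j < 2 * N" for i j
  proof (cases "i = j")
    case True
    then show ?thesis
      using that dim zero_mem by (auto simp: C_step_def zero_ereal_def)
  next
    case False
    let ?A = "{m $$ (i, j), m $$ (i, k) + m $$ (k, j), m $$ (i, bar k) + m $$ (bar k, j),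
      m $$ (i, k) + m $$ (k, bar k) + m $$ (bar k, j),
      m $$ (i, bar k) + m $$ (bar k, k) + m $$ (k, j)}"
    have A: "?A \<subseteq> ?J"
      unfolding insert_subset using that k by (intro conjI empty_subsetI add J) simp_all
    have Min: "Min ?A \<in> ?A"
      by (rule Min_in) auto
    have C: "C_step k m $$ (i, j) = Min ?A"
      using that dim False by (simp add: C_step_def)
    show ?thesis
      unfolding C by (rule subsetD[OF A Min])
  qed
  then show ?thesis
    unfolding dbm_def by (auto simp: dim)
qed

lemma (in scalar_set) dbm_S_step:
  assumes m: "dbm I (2 * N) m"
  shows "dbm I (2 * N) (S_step m)"
proof -
  let ?J = "ereal ` I \<union> {\<infinity>}"
  have dim: "dim_row m = 2 * N" "dim_col m = 2 * N"
    using m by (auto simp: dbm_def)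
  have J: "m $$ (i, j) \<in> ?J" if "i < 2 * N" "j < 2 * N" for i j
    using m that by (auto simp: dbm_def)
  have "(a + b) / 2 \<in> I" if "a \<in> I" "b \<in> I" for a b
    using that add_mem half_mem by blast
  then have half: "(x + y) / 2 \<in> ?J" if "x \<in> ?J" "y \<in> ?J" for x y
    using that by (auto intro!: imageI)
  have "S_step m $$ (i, j) \<in> ?J" if "i < 2 * N" "j < 2 * N" for i j
    using that J[OF that] half[OF J J, of i "bar i" "bar j" j] dim
    by (simp add: S_step_def min_def)
  then show ?thesis
    unfolding dbm_def by (auto simp: dim)
qed

section \<open>Floyd-Warshall relaxation with a single pivot\<close>

definition pivot :: "nat \<Rightarrow> ereal mat \<Rightarrow> ereal mat" where
  "pivot k m = mat (dim_row m) (dim_col m) (\<lambda>(i, j). min (m $$ (i, j)) (m $$ (i, k) + m $$ (k, j)))"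

text \<open>Excludes -\<infinity> for matrices, such as relaxed ones, for which \<open>dbm\<close>
  is not at hand: a feasible point bounds every entry from below by a real.\<close>

lemma feasible_not_MInf:
  assumes "feasible V m s" "i \<in> V" "j \<in> V"
  shows "m $$ (i, j) \<noteq> -\<infinity>"
  using assms unfolding feasible_def by fastforce

context
  fixes n k :: nat and m :: "ereal mat" and s :: "nat \<Rightarrow> real"
  assumes m: "m \<in> carrier_mat n n" and k: "k < n" and s: "feasible {..<n} m s"
begin

lemma pivot_carrier: "pivot k m \<in> carrier_mat n n"
  using m by (auto simp: pivot_def)

lemma pivot_le_iff:
  assumes "i < n" "j < n"
  shows "pivot k m $$ (i, j) \<le> ereal c \<longleftrightarrow> m $$ (i, j) \<le> ereal c \<or>
    (\<exists>a b. m $$ (i, k) \<le> ereal a \<and> m $$ (k, j) \<le> ereal b \<and> a + b \<le> c)"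
  using assms k carrier_matD[OF m] feasible_not_MInf[OF s]
  by (simp add: pivot_def min_le_iff_disj ereal_add_le_iff)

lemma feasible_pivot: "feasible {..<n} (pivot k m) s"
proof (rule feasibleI)
  fix i j c
  assume *: "i \<in> {..<n}" "j \<in> {..<n}" "pivot k m $$ (i, j) \<le> ereal c"
  then have ij: "i < n" "j < n"
    by auto
  have b: "s j - s i \<le> c" if "m $$ (i, j) \<le> ereal c" "i < n" "j < n" for i j c
    using feasible_bound[OF s that(1)] that(2,3) by simp
  show "s j - s i \<le> c"
    using *(3) unfolding pivot_le_iff[OF ij]
    by (auto dest!: b[OF _ ij] b[OF _ ij(1) k] b[OF _ k ij(2)])
qed (rule feasible_bar[OF s])

text \<open>Each of the two legs meeting at \<open>p\<close> may or may not have been relaxed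
  through \<open>k\<close>. A single visit to \<open>k\<close> is again a relaxed path, by the
  triangle inequality through \<open>p\<close> in \<open>m\<close>; between two visits lies a cycle
  of non-negative weight, which is cut out.\<close>

lemma closed_at_pivot:
  assumes p: "p < n" "closed_at m p \<or> p = k"
  shows "closed_at (pivot k m) p"
proof (rule closed_atI; unfold carrier_matD(1)[OF pivot_carrier])
  fix i j a b
  assume ij: "i < n" "j < n" and ab: "pivot k m $$ (i, p) \<le> ereal a" "pivot k m $$ (p, j) \<le> ereal b"
  have cycle: "0 \<le> a + b" if "m $$ (k, p) \<le> ereal a" "m $$ (p, k) \<le> ereal b" for a b
    using feasible_bound[OF s that(1)] feasible_bound[OF s that(2)] k p by simp
  have closed: "m $$ (i, j) \<le> ereal (a + b)"
    if "m $$ (i, p) \<le> ereal a" "m $$ (p, j) \<le> ereal b" "p \<noteq> k" "i < n" "j < n" for i j a b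
    using closed_atD[of m p i j a b] that p(2) m by auto
  note iff = pivot_le_iff[OF ij] pivot_le_iff[OF ij(1) p(1)] pivot_le_iff[OF p(1) ij(2)]
  consider (direct) "m $$ (i, p) \<le> ereal a" "m $$ (p, j) \<le> ereal b"
    | (right) x y where "m $$ (i, p) \<le> ereal a" "m $$ (p, k) \<le> ereal x" "m $$ (k, j) \<le> ereal y"
        "x + y \<le> b"
    | (left) x y where "m $$ (i, k) \<le> ereal x" "m $$ (k, p) \<le> ereal y" "x + y \<le> a"
        "m $$ (p, j) \<le> ereal b"
    | (both) x y z w where "m $$ (i, k) \<le> ereal x" "m $$ (k, p) \<le> ereal y" "x + y \<le> a"
        "m $$ (p, k) \<le> ereal z" "m $$ (k, j) \<le> ereal w" "z + w \<le> b"
    using ab unfolding iff by blast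
  then show "pivot k m $$ (i, j) \<le> ereal (a + b)"
  proof cases
    case direct
    then show ?thesis
      unfolding iff using closed[OF direct _ ij] by (cases "p = k") auto
  next
    case right
    show ?thesis
    proof (cases "p = k")
      case True
      then have "0 \<le> x"
        using feasible_bound[OF s right(2)] k by simp
      then show ?thesis
        unfolding iff using right True by (intro disjI2 exI[of _ a] exI[of _ y]) auto
    next
      case False
      then show ?thesis
        unfolding iff using closed[OF right(1,2) False ij(1) k] right
        by (intro disjI2 exI[of _ "a + x"] exI[of _ y]) auto
    qed
  next
    case left
    show ?thesis
    proof (cases "p = k")
      case True
      then have "0 \<le> y"
        using feasible_bound[OF s left(2)] k by simp
      then show ?thesis
        unfolding iff using left True by (intro disjI2 exI[of _ x] exI[of _ b]) auto
    next
      case False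
      then show ?thesis
        unfolding iff using closed[OF left(2,4) False k ij(2)] left
        by (intro disjI2 exI[of _ x] exI[of _ "y + b"]) auto
    qed
  next
    case both
    then show ?thesis
      unfolding iff using cycle[OF both(2,4)] by (intro disjI2 exI[of _ x] exI[of _ w]) auto
  qed
qed (use p feasible_not_MInf[OF feasible_pivot] in auto)

end

text \<open>Since all cycles have non-negative weight, a step with the pivots \<open>k\<close> and \<open>bar k\<close> amounts, off
  the diagonal, to two Floyd--Warshall steps.\<close>

lemma C_step_le_iff_pivot:
  assumes m: "dbm I (2 * N) m" and s: "feasible {..<2 * N} m s"
    and i: "i < 2 * N" and j: "j < 2 * N" and k: "k < 2 * N"
  shows "C_step k m $$ (i, j) \<le> ereal c \<longleftrightarrow>
    (if i = j then 0 \<le> c else pivot (bar k) (pivot k m) $$ (i, j) \<le> ereal c)"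
proof -
  have car: "m \<in> carrier_mat (2 * N) (2 * N)"
    using m by (simp add: dbm_def)
  have k': "bar k < 2 * N"
    using k by simp
  have cycle: "0 \<le> a + b" if "m $$ (k, bar k) \<le> ereal a" "m $$ (bar k, k) \<le> ereal b" for a b
    using feasible_bound[OF s that(1)] feasible_bound[OF s that(2)] k by simp
  note piv = pivot_le_iff[OF car k s]
    pivot_le_iff[OF pivot_carrier[OF car k s] k' feasible_pivot[OF car k s] i j]
  note iff = C_step_le_iff[OF m i j k] piv(2) piv(1)[OF i j] piv(1)[OF i k'] piv(1)[OF k' j]
  show ?thesis
  proof (cases "i = j")
    case False
    show ?thesis
      unfolding iff if_not_P[OF False]
    proof (rule iffI, goal_cases)
      case 1
      then consider "m $$ (i, j) \<le> ereal c"
        | "\<exists>a b. m $$ (i, k) \<le> ereal a \<and> m $$ (k, j) \<le> ereal b \<and> a + b \<le> c"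
        | "\<exists>a b. m $$ (i, bar k) \<le> ereal a \<and> m $$ (bar k, j) \<le> ereal b \<and> a + b \<le> c"
        | a d b where "m $$ (i, k) \<le> ereal a" "m $$ (k, bar k) \<le> ereal d"
            "m $$ (bar k, j) \<le> ereal b" "(a + d) + b \<le> c"
        | a d b where "m $$ (i, bar k) \<le> ereal a" "m $$ (bar k, k) \<le> ereal d"
            "m $$ (k, j) \<le> ereal b" "a + (d + b) \<le> c"
        by (auto simp: add.assoc)
      then show ?case
        by cases blast+
    next
      case 2
      then consider "m $$ (i, j) \<le> ereal c"
        | "\<exists>a b. m $$ (i, k) \<le> ereal a \<and> m $$ (k, j) \<le> ereal b \<and> a + b \<le> c"
        | a b where "a + b \<le> c" "m $$ (i, bar k) \<le> ereal a" "m $$ (bar k, j) \<le> ereal b"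
        | a b x y where "a + b \<le> c" "m $$ (i, bar k) \<le> ereal a"
            "m $$ (bar k, k) \<le> ereal x" "m $$ (k, j) \<le> ereal y" "x + y \<le> b"
        | a b x y where "a + b \<le> c" "m $$ (bar k, j) \<le> ereal b"
            "m $$ (i, k) \<le> ereal x" "m $$ (k, bar k) \<le> ereal y" "x + y \<le> a"
        | a b x y z w where "a + b \<le> c" "m $$ (i, k) \<le> ereal x" "m $$ (k, bar k) \<le> ereal y"
            "x + y \<le> a" "m $$ (bar k, k) \<le> ereal z" "m $$ (k, j) \<le> ereal w" "z + w \<le> b"
        by blast
      then show ?case
      proof cases
        case (4 a b x y)
        then have "a + x + y \<le> c"
          by simp
        with 4 show ?thesis
          by blast
      next
        case (5 a b x y)
        then have "x + y + b \<le> c"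
          by simp
        with 5 show ?thesis
          by blast
      next
        \<comment> \<open>The path \<open>i\<close>, \<open>k\<close>, \<open>bar k\<close>,
          \<open>k\<close>, \<open>j\<close> is the only one without a counterpart in
          \<open>C_step\<close>; cutting its cycle leaves \<open>i\<close>, \<open>k\<close>,
          \<open>j\<close>.\<close>
        case (6 a b x y z w)
        then have "x + w \<le> c"
          using cycle[of y z] by simp
        with 6 show ?thesis
          by blast
      qed blast+
    qed
  next
    case True
    then show ?thesis
      unfolding C_step_le_iff[OF m i j k] by simp
  qed
qed

text \<open>Off the diagonal the claim is inherited from the two relaxations. The zeros written on
  the diagonal matter when \<open>i = j\<close>, where feasibility gives
  \<open>0 \<le> a + b\<close>, and when \<open>p\<close> is an endpoint, where one summand is
  non-negative and the other bounds the entry.\<close>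

lemma closed_at_C_step:
  assumes m: "dbm I (2 * N) m" and s: "feasible {..<2 * N} m s"
    and k: "k < 2 * N" and p: "p < 2 * N" "closed_at m p \<or> p = k \<or> p = bar k"
  shows "closed_at (C_step k m) p"
proof -
  have car: "m \<in> carrier_mat (2 * N) (2 * N)" and dim: "dim_row m = 2 * N"
    using m by (auto simp: dbm_def)
  have k': "bar k < 2 * N"
    using k by simp
  let ?M = "pivot (bar k) (pivot k m)"
  note s1 = feasible_pivot[OF car k s]
  note car2 = pivot_carrier[OF pivot_carrier[OF car k s] k' s1]
  have closed: "closed_at ?M p"
    using closed_at_pivot[OF pivot_carrier[OF car k s] k' s1 p(1)]
      closed_at_pivot[OF car k s p(1)] p(2) by blast
  note iff = C_step_le_iff_pivot[OF m s _ _ k]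
  note b = feasible_bound[OF feasible_C_step[OF m k s]]
  show ?thesis
  proof (rule closed_atI; unfold dim_C_step dim)
    fix i j a b
    assume ij: "i < 2 * N" "j < 2 * N"
      and ab: "C_step k m $$ (i, p) \<le> ereal a" "C_step k m $$ (p, j) \<le> ereal b"
    have "0 \<le> a + b" if "i = j"
      using b[OF ab(1)] b[OF ab(2)] ij p(1) that by simp
    moreover have "C_step k m $$ (i, j) \<le> ereal (a + b)" if "i = p"
      using ab that ij by (auto simp: iff intro: order_trans)
    moreover have "C_step k m $$ (i, j) \<le> ereal (a + b)" if "j = p"
      using ab that ij by (auto simp: iff intro: order_trans)
    moreover have "?M $$ (i, j) \<le> ereal (a + b)" if "i \<noteq> p" "j \<noteq> p"
      using closed_atD[OF closed, of i j a b] carrier_matD[OF car2] ab that ij p(1)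
      by (simp add: iff)
    ultimately show "C_step k m $$ (i, j) \<le> ereal (a + b)"
      using ij by (cases "i = j"; cases "i = p"; cases "j = p") (simp_all add: iff)
  qed (use p feasible_not_MInf[OF feasible_C_step[OF m k s]] in auto)
qed

text \<open>If one leg is an average, say the second, coherence lets the first be traversed twice:
  the path \<open>i\<close>, \<open>p\<close>, \<open>bar p\<close>, \<open>bar i\<close> bounds the
  entry at \<open>(i, bar i)\<close>, and averaging with \<open>(bar j, j)\<close> gives the claim.
  This path uses both pivots \<open>p\<close> and \<open>bar p\<close>. If both legs are averages,
  the cycle between \<open>p\<close> and \<open>bar p\<close> is dropped.\<close>

lemma closed_at_S_step:
  assumes m: "dbm I (2 * N) m" and s: "feasible {..<2 * N} m s" and coh: "coherent m"
    and p: "p < 2 * N" and closed: "closed_at m p" "closed_at m (bar p)"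
  shows "closed_at (S_step m) p"
proof -
  have car: "m \<in> carrier_mat (2 * N) (2 * N)" and dim: "dim_row m = 2 * N"
    using m by (auto simp: dbm_def)
  note c = closed_atD[OF closed(1), unfolded dim] closed_atD[OF closed(2), unfolded dim]
  show ?thesis
  proof (rule closed_atI; unfold dim_S_step dim)
    fix i j a b
    assume ij: "i < 2 * N" "j < 2 * N"
      and ab: "S_step m $$ (i, p) \<le> ereal a" "S_step m $$ (p, j) \<le> ereal b"
    note iff = S_step_le_iff[OF m ij] S_step_le_iff[OF m ij(1) p] S_step_le_iff[OF m p ij(2)]
    have bars: "bar i < 2 * N" "bar j < 2 * N" "bar p < 2 * N"
      using ij p by auto
    consider (direct) "m $$ (i, p) \<le> ereal a" "m $$ (p, j) \<le> ereal b"
      | (right) x y where "m $$ (i, p) \<le> ereal a" "m $$ (p, bar p) \<le> ereal x"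
          "m $$ (bar j, j) \<le> ereal y" "x + y \<le> 2 * b"
      | (left) x y where "m $$ (i, bar i) \<le> ereal x" "m $$ (bar p, p) \<le> ereal y" "x + y \<le> 2 * a"
          "m $$ (p, j) \<le> ereal b"
      | (both) x y z w where "m $$ (i, bar i) \<le> ereal x" "m $$ (bar p, p) \<le> ereal y"
          "x + y \<le> 2 * a" "m $$ (p, bar p) \<le> ereal z" "m $$ (bar j, j) \<le> ereal w"
          "z + w \<le> 2 * b"
      using ab unfolding iff by blast
    then show "S_step m $$ (i, j) \<le> ereal (a + b)"
    proof cases
      case direct
      then show ?thesis
        unfolding iff using c(1)[OF ij direct] by blast
    next
      case right
      have "m $$ (bar p, bar i) \<le> ereal a"
        using right(1) coherentD[OF coh car ij(1) p] by simp
      from c(2)[OF ij(1) bars(1) c(1)[OF ij(1) bars(3) right(1,2)] this] show ?thesis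
        unfolding iff using right by (intro disjI2 exI[of _ "a + x + a"] exI[of _ y]) auto
    next
      case left
      have "m $$ (bar j, bar p) \<le> ereal b"
        using left(4) coherentD[OF coh car p ij(2)] by simp
      from c(1)[OF bars(2) ij(2) c(2)[OF bars(2) p this left(2)] left(4)] show ?thesis
        unfolding iff using left by (intro disjI2 exI[of _ x] exI[of _ "b + y + b"]) auto
    next
      case both
      have "0 \<le> y + z"
        using feasible_bound[OF s both(2)] feasible_bound[OF s both(4)] p by simp
      then show ?thesis
        unfolding iff using both by (intro disjI2 exI[of _ x] exI[of _ w]) auto
    qed
  qed (use p feasible_not_MInf[OF feasible_S_step[OF m s]] in auto)
qed

text \<open>At \<open>(i, bar i)\<close> the step averages an entry with itself and changes nothing,
  so the two bounds already hold in \<open>m\<close>.\<close>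

lemma S_step_strong:
  assumes m: "dbm I (2 * N) m" and ij: "i < 2 * N" "j < 2 * N"
    and ab: "S_step m $$ (i, bar i) \<le> ereal a" "S_step m $$ (bar j, j) \<le> ereal b"
  shows "S_step m $$ (i, j) \<le> ereal ((a + b) / 2)"
proof -
  have half: "z \<le> ereal c" if "z \<le> ereal c \<or> (\<exists>a b. z \<le> ereal a \<and> z \<le> ereal b \<and> a + b \<le> 2 * c)"
    for z :: ereal and c
    using that by (cases z) auto
  have "m $$ (i, bar i) \<le> ereal a" "m $$ (bar j, j) \<le> ereal b"
    using ab ij half[of "m $$ (i, bar i)" a] half[of "m $$ (bar j, j)" b]
    by (simp_all add: S_step_le_iff[OF m])
  then show ?thesis
    unfolding S_step_le_iff[OF m ij] by (intro disjI2 exI[of _ a] exI[of _ b]) auto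
qed
lemma C_step_diag: "i < dim_row m \<Longrightarrow> i < dim_col m \<Longrightarrow> C_step k m $$ (i, i) = 0"
  by (simp add: C_step_def)

subsection \<open>The strong closure is strongly closed\<close>

text \<open>Strength, the last conjunct, is phrased through finite upper bounds. On the diagonal
  only non-positivity is asked; a feasible point supplies the converse bound.\<close>

definition strongly_closed :: "nat \<Rightarrow> ereal mat \<Rightarrow> bool" where
  "strongly_closed N m \<longleftrightarrow> coherent m \<and> (\<forall>p<2 * N. closed_at m p) \<and>
     (\<forall>i<2 * N. m $$ (i, i) \<le> 0) \<and>
     (\<forall>i<2 * N. \<forall>j<2 * N. \<forall>a b. m $$ (i, bar i) \<le> ereal a \<longrightarrow> m $$ (bar j, j) \<le> ereal b \<longrightarrow>
        m $$ (i, j) \<le> ereal ((a + b) / 2))"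

context scalar_set
begin

text \<open>Each round treats an even pivot together with its bar, so the finished pivots form whole
  pairs, as \<open>closed_at_S_step\<close> demands. The feasible point \<open>t\<close> is carried
  along to keep cycles non-negative.\<close>

lemma strong_closure_iter_invariant:
  assumes m: "dbm I (2 * N) m" and coh: "coherent m" and t: "feasible {..<2 * N} m t" and "K \<le> N"
  defines "M \<equiv> strong_closure_iter m"
  shows "dbm I (2 * N) (M K) \<and> coherent (M K) \<and>
    (\<forall>s. feasible {..<2 * N} (M K) s \<longleftrightarrow> feasible {..<2 * N} m s) \<and>
    (\<forall>p<2 * K. closed_at (M K) p)"
  using \<open>K \<le> N\<close>
proof (induction K)
  case 0
  then show ?case
    using m coh by (simp add: M_def)
next
  case (Suc K)
  then have k: "2 * K < 2 * N" and IH: "dbm I (2 * N) (M K)" "coherent (M K)"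
      "\<And>s. feasible {..<2 * N} (M K) s \<longleftrightarrow> feasible {..<2 * N} m s"
      "\<And>p. p < 2 * K \<Longrightarrow> closed_at (M K) p"
    by auto
  have t1: "feasible {..<2 * N} (M K) t"
    using t IH(3) by blast
  let ?C = "C_step (2 * K) (M K)"
  have step: "M (Suc K) = S_step ?C"
    by (simp add: M_def)
  have C: "dbm I (2 * N) ?C" and t2: "feasible {..<2 * N} ?C t"
    using dbm_C_step[OF IH(1) k] feasible_C_step[OF IH(1) k t1] by auto
  have car: "M K \<in> carrier_mat (2 * N) (2 * N)" "?C \<in> carrier_mat (2 * N) (2 * N)"
    using IH(1) C by (auto simp: dbm_def)
  note coh_C = coherent_C_step[OF IH(2) car(1) k]
  have closed: "closed_at ?C p" if "p < 2 * Suc K" for p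
  proof (rule closed_at_C_step[OF IH(1) t1 k])
    show "closed_at (M K) p \<or> p = 2 * K \<or> p = bar (2 * K)"
      using IH(4)[of p] that by (auto simp: bar_even less_Suc_eq)
  qed (use that Suc.prems in simp)
  have "closed_at (M (Suc K)) p" if "p < 2 * Suc K" for p
  proof -
    have "p < 2 * N" "bar p < 2 * Suc K"
      using that Suc.prems by (simp, subst bar_less)
    then show ?thesis
      unfolding step using that by (intro closed_at_S_step[OF C t2 coh_C] closed)
  qed
  moreover have "feasible {..<2 * N} (M (Suc K)) s \<longleftrightarrow> feasible {..<2 * N} m s" for s
    unfolding step feasible_S_step_iff[OF C] feasible_C_step_iff[OF IH(1) k t1] by (rule IH(3))
  ultimately show ?case
    unfolding step using dbm_S_step[OF C] coherent_S_step[OF coh_C car(2)] by blast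
qed

lemma
  assumes m: "dbm I (2 * N) m" and coh: "coherent m" and t: "feasible {..<2 * N} m t" and N: "N \<ge> 1"
  shows dbm_strong_closure: "dbm I (2 * N) (strong_closure m)"
    and feasible_strong_closure_iff:
      "feasible {..<2 * N} (strong_closure m) s \<longleftrightarrow> feasible {..<2 * N} m s"
    and strongly_closed_strong_closure: "strongly_closed N (strong_closure m)"
proof -
  \<comment> \<open>Strength and the diagonal are not in the invariant; they are read off the last
    round, which exists because \<open>N\<close> is positive.\<close>
  obtain K where K: "N = Suc K"
    using N by (cases N) auto
  have eq: "strong_closure m = strong_closure_iter m N"
    using m by (auto simp: strong_closure_def dbm_def)
  note inv = strong_closure_iter_invariant[OF m coh t order_refl]
  show "dbm I (2 * N) (strong_closure m)"
    "feasible {..<2 * N} (strong_closure m) s \<longleftrightarrow> feasible {..<2 * N} m s"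
    unfolding eq using inv by blast+
  let ?M = "strong_closure_iter m K" and ?C = "C_step (2 * K) (strong_closure_iter m K)"
  have M: "dbm I (2 * N) ?M"
    using strong_closure_iter_invariant[OF m coh t, of K] K by simp
  have C: "dbm I (2 * N) ?C"
    using dbm_C_step[OF M] K by simp
  have step: "strong_closure m = S_step ?C"
    unfolding eq K by simp
  have "strong_closure m $$ (i, i) \<le> 0" if "i < 2 * N" for i
    using S_step_le_iff[OF C that that, of 0] C_step_diag[of i ?M "2 * K"] M that
    by (auto simp: step dbm_def zero_ereal_def)
  then show "strongly_closed N (strong_closure m)"
    using inv S_step_strong[OF C] unfolding strongly_closed_def step[symmetric] eq[symmetric] by blast
qed

subsection \<open>Attained bounds\<close>

text \<open>One-dimensional Helly theorem: \<open>A\<close> and \<open>B\<close> are the upper bounds on \<open>x\<close> and \<open>- x\<close>.\<close>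

lemma exists_between_bounds:
  assumes "finite A" "finite B" "A \<subseteq> ereal ` I \<union> {\<infinity>}" "B \<subseteq> ereal ` I \<union> {\<infinity>}"
    and AB: "\<And>a b. ereal a \<in> A \<Longrightarrow> ereal b \<in> B \<Longrightarrow> 0 \<le> a + b"
  obtains x where "x \<in> I" "\<And>c. ereal c \<in> A \<Longrightarrow> x \<le> c" "\<And>c. ereal c \<in> B \<Longrightarrow> - x \<le> c"
proof -
  define A' B' where "A' = {a \<in> I. ereal a \<in> A}" and "B' = {b \<in> I. ereal b \<in> B}"
  have fin: "finite A'" "finite B'"
    using assms(1,2) finite_vimageI[of _ ereal] unfolding A'_def B'_def
    by (auto intro: finite_subset[of _ "ereal -` A"] finite_subset[of _ "ereal -` B"] simp: inj_def)
  have mem: "a \<in> A'" if "ereal a \<in> A" for a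
    using assms(3) that by (auto simp: A'_def)
  have mem': "b \<in> B'" if "ereal b \<in> B" for b
    using assms(4) that by (auto simp: B'_def)
  have AB': "0 \<le> a + b" if "a \<in> A'" "b \<in> B'" for a b
    using AB that by (auto simp: A'_def B'_def)
  \<comment> \<open>An extremal bound is itself taken as \<open>x\<close>, which keeps it in
    \<open>I\<close>: the least upper bound on \<open>x\<close> if there is one, else the negated
    least bound on \<open>- x\<close>, else \<open>0\<close>.\<close>
  show ?thesis
  proof (cases "A' = {}")
    case False
    then have "Min A' \<in> A'"
      using fin by simp
    then show ?thesis
      using that[of "Min A'"] AB'[of "Min A'"] fin mem mem'
      by (force simp: A'_def minus_le_iff)
  next
    case A: True
    show ?thesis
    proof (cases "B' = {}")
      case False
      then have "Min B' \<in> B'"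
        using fin by simp
      then show ?thesis
        using that[of "- Min B'"] fin mem mem' A uminus_mem by (auto simp: B'_def)
    next
      case True
      then show ?thesis
        using that[of 0] mem mem' A zero_mem by auto
    qed
  qed
qed

section \<open>Extension of a partial solution with values in \<open>I\<close>\<close>

lemma ereal_add_mem:
  assumes "x \<in> ereal ` I \<union> {\<infinity>}" "c \<in> I"
  shows "ereal c + x \<in> ereal ` I \<union> {\<infinity>}"
  using assms add_mem by auto

lemma ereal_half_mem:
  assumes "x \<in> ereal ` I \<union> {\<infinity>}"
  shows "x / ereal 2 \<in> ereal ` I \<union> {\<infinity>}"
  using assms half_mem by (auto intro!: imageI)

text \<open>Fourier-Motzkin elimination in reverse: an upper and a lower bound on the new value
  never conflict, because the path through \<open>k\<close> that combines them is already bounded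
  below, by \<open>s\<close> on \<open>V\<close> or by \<open>t\<close> at \<open>k\<close>.\<close>

lemma extend_feasible_one:
  assumes m: "dbm I (2 * N) m" and closed: "strongly_closed N m" and t: "feasible {..<2 * N} m t"
    and V: "V \<subseteq> {..<2 * N}" "bar ` V \<subseteq> V" and k: "k < 2 * N" "k \<notin> V"
    and s: "feasible V m s" "\<And>i. s i \<in> I"
  obtains x where "x \<in> I" "feasible (insert k (insert (bar k) V)) m (s(k := x, bar k := - x))"
proof -
  have car: "m \<in> carrier_mat (2 * N) (2 * N)" and dim: "dim_row m = 2 * N"
    using m by (auto simp: dbm_def)
  have mem: "m $$ (i, j) \<in> ereal ` I \<union> {\<infinity>}" if "i < 2 * N" "j < 2 * N" for i j
    using m that by (simp add: dbm_def)
  have tri: "m $$ (i, j) \<le> ereal (a + b)"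
    if "m $$ (i, p) \<le> ereal a" "m $$ (p, j) \<le> ereal b" "i < 2 * N" "j < 2 * N" "p < 2 * N" for i j p a b
    using closed_atD[of m p i j a b] closed that by (simp add: strongly_closed_def dim)
  have coh: "m $$ (i, j) = m $$ (bar j, bar i)" if "i < 2 * N" "j < 2 * N" for i j
    using closed coherentD[OF _ car that] by (simp add: strongly_closed_def)
  have V': "i < 2 * N" "bar i \<in> V" if "i \<in> V" for i
    using V that by auto
  have k': "bar k < 2 * N" "bar k \<notin> V"
    using k V'(2)[of "bar k"] by auto
  \<comment> \<open>Entries with index \<open>bar k\<close> and one index in \<open>V\<close> are
    left out, since coherence identifies them with entries at \<open>k\<close>. The entry at
    \<open>(bar k, k)\<close> bounds \<open>2 * x\<close>, hence the halving.\<close>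
  define A where
    "A = insert (m $$ (bar k, k) / ereal 2) ((\<lambda>i. ereal (s i) + m $$ (i, k)) ` V)"
  define B where
    "B = insert (m $$ (k, bar k) / ereal 2) ((\<lambda>j. ereal (- s j) + m $$ (k, j)) ` V)"
  have A_cases: "m $$ (bar k, k) = ereal (2 * a) \<or> (\<exists>i\<in>V. m $$ (i, k) = ereal (a - s i))"
    if "ereal a \<in> A" for a
  proof -
    have "m $$ (i, k) = ereal (a - s i)" if "ereal a = ereal (s i) + m $$ (i, k)" for i
      using that by (cases "m $$ (i, k)") auto
    moreover have "m $$ (bar k, k) = ereal (2 * a)" if "ereal a = m $$ (bar k, k) / ereal 2"
      using that by (cases "m $$ (bar k, k)") auto
    ultimately show ?thesis
      using that unfolding A_def by blast
  qed
  have B_cases: "m $$ (k, bar k) = ereal (2 * b) \<or> (\<exists>j\<in>V. m $$ (k, j) = ereal (b + s j))"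
    if "ereal b \<in> B" for b
  proof -
    have "m $$ (k, j) = ereal (b + s j)" if "ereal b = ereal (- s j) + m $$ (k, j)" for j
      using that by (cases "m $$ (k, j)") auto
    moreover have "m $$ (k, bar k) = ereal (2 * b)" if "ereal b = m $$ (k, bar k) / ereal 2"
      using that by (cases "m $$ (k, bar k)") auto
    ultimately show ?thesis
      using that unfolding B_def by blast
  qed
  have finV: "finite V"
    using V(1) finite_subset by blast
  have "finite A" "finite B"
    using finV by (auto simp: A_def B_def)
  moreover have "A \<subseteq> ereal ` I \<union> {\<infinity>}"
    unfolding A_def insert_subset image_subset_iff using V'(1) k(1) k'(1) s(2)
    by (intro conjI ballI ereal_half_mem ereal_add_mem mem)
  moreover have "B \<subseteq> ereal ` I \<union> {\<infinity>}"
    unfolding B_def insert_subset image_subset_iff using V'(1) k(1) k'(1) s(2)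
    by (intro conjI ballI ereal_half_mem ereal_add_mem mem uminus_mem)
  moreover have "0 \<le> a + b" if ab: "ereal a \<in> A" "ereal b \<in> B" for a b
    using A_cases[OF ab(1)] B_cases[OF ab(2)]
  proof (elim disjE bexE)
    \<comment> \<open>Neither index lies in \<open>V\<close>, so the weight of this cycle is tested
      at \<open>t\<close> instead of \<open>s\<close>.\<close>
    assume *: "m $$ (bar k, k) = ereal (2 * a)" "m $$ (k, bar k) = ereal (2 * b)"
    show ?thesis
      using feasible_bound[OF t, of "bar k" k "2 * a"] feasible_bound[OF t, of k "bar k" "2 * b"]
        * k(1) k'(1) feasible_bar[OF t, of k] by simp
  next
    \<comment> \<open>The bound on \<open>- x\<close> is used twice, along the path
      \<open>bar j\<close>, \<open>bar k\<close>, \<open>k\<close>, \<open>j\<close>, whose length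
      bounds \<open>2 * s j\<close>.\<close>
    fix j assume j: "j \<in> V" and *: "m $$ (bar k, k) = ereal (2 * a)" "m $$ (k, j) = ereal (b + s j)"
    have "m $$ (bar j, bar k) = ereal (b + s j)"
      using coh[of k j] V' k j * by simp
    then have "m $$ (bar j, j) \<le> ereal ((b + s j) + 2 * a + (b + s j))"
      using V' j k(1) k'(1) * tri[of "bar j" "bar k" "b + s j" k "2 * a"]
        tri[of "bar j" k "(b + s j) + 2 * a" j "b + s j"] by simp
    then show ?thesis
      using feasible_bound[OF s(1), of "bar j" j] feasible_bar[OF s(1), of j] V' j by fastforce
  next
    fix i assume i: "i \<in> V" and *: "m $$ (i, k) = ereal (a - s i)" "m $$ (k, bar k) = ereal (2 * b)"
    have "m $$ (bar k, bar i) = ereal (a - s i)"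
      using coh[of i k] V' k i * by simp
    then have "m $$ (i, bar i) \<le> ereal ((a - s i) + 2 * b + (a - s i))"
      using V' i k(1) k'(1) * tri[of i k "a - s i" "bar k" "2 * b"]
        tri[of i "bar k" "(a - s i) + 2 * b" "bar i" "a - s i"] by simp
    then show ?thesis
      using feasible_bound[OF s(1), of i "bar i"] feasible_bar[OF s(1), of i] V' i by fastforce
  next
    fix i j assume ij: "i \<in> V" "j \<in> V"
      and *: "m $$ (i, k) = ereal (a - s i)" "m $$ (k, j) = ereal (b + s j)"
    have "m $$ (i, j) \<le> ereal ((a - s i) + (b + s j))"
      using V' ij k(1) * tri[of i k "a - s i" j "b + s j"] by simp
    then show ?thesis
      using feasible_bound[OF s(1)] ij by fastforce
  qed
  ultimately obtain x where x: "x \<in> I" "\<And>c. ereal c \<in> A \<Longrightarrow> x \<le> c" "\<And>c. ereal c \<in> B \<Longrightarrow> - x \<le> c"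
    using exists_between_bounds by blast
  have upper: "x \<le> s i + c" if "i \<in> V" "m $$ (i, k) = ereal c" for i c
    using x(2)[of "s i + c"] that by (force simp: A_def)
  have lower: "- x \<le> - s j + c" if "j \<in> V" "m $$ (k, j) = ereal c" for j c
    using x(3)[of "- s j + c"] that by (force simp: B_def)
  have double: "x \<le> c / 2" if "m $$ (bar k, k) = ereal c" for c
    using x(2)[of "c / 2"] that by (simp add: A_def)
  have double': "- x \<le> c / 2" if "m $$ (k, bar k) = ereal c" for c
    using x(3)[of "c / 2"] that by (simp add: B_def)
  define s' where "s' = s(k := x, bar k := - x)"
  have s'_V: "s' i = s i" if "i \<in> V" for i
    using that k(2) k'(2) by (auto simp: s'_def)
  have s'_k: "s' k = x" "s' (bar k) = - x"
    by (simp_all add: s'_def)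
  have s'_bar: "s' (bar i) = - s' i" for i
    using feasible_bar[OF s(1), of i] by (auto simp: s'_def bar_swap)
  have diag: "0 \<le> c" if "m $$ (i, i) = ereal c" "i < 2 * N" for i c
    using feasible_bound[OF t, of i i c] that by simp
  have bound: "s' j - s' i \<le> c" if ij: "i \<in> insert k (insert (bar k) V)"
    "j \<in> insert k (insert (bar k) V)" and c: "m $$ (i, j) = ereal c" for i j c
  proof -
    consider "i \<in> V" "j \<in> V" | "i \<in> V" "j = k" | "i \<in> V" "j = bar k" | "i = k" "j \<in> V"
      | "i = bar k" "j \<in> V" | "i = k" "j = bar k" | "i = bar k" "j = k" | "i = j" "i < 2 * N"
      using ij k(1) k'(1) by blast
    then show ?thesis
    proof cases
      case 1
      then show ?thesis
        using feasible_bound[OF s(1), of i j c] c by (simp add: s'_V)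
    next
      case 2
      then show ?thesis
        using upper[of i c] c by (simp add: s'_V s'_k)
    next
      case 3
      then show ?thesis
        using lower[of "bar i" c] c coh[of i "bar k"] V' k'(1) feasible_bar[OF s(1), of i]
        by (simp add: s'_V s'_k)
    next
      case 4
      then show ?thesis
        using lower[of j c] c by (simp add: s'_V s'_k)
    next
      case 5
      then show ?thesis
        using upper[of "bar j" c] c coh[of "bar k" j] V' k'(1) feasible_bar[OF s(1), of j]
        by (simp add: s'_V s'_k)
    next
      case 6
      then show ?thesis
        using double'[of c] c by (simp add: s'_k)
    next
      case 7
      then show ?thesis
        using double[of c] c by (simp add: s'_k)
    next
      case 8
      then show ?thesis
        using diag c by simp
    qed
  qed
  have "feasible (insert k (insert (bar k) V)) m s'"
  proof (rule feasibleI)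
    fix i j c
    assume ij: "i \<in> insert k (insert (bar k) V)" "j \<in> insert k (insert (bar k) V)"
      and c: "m $$ (i, j) \<le> ereal c"
    then have "m $$ (i, j) \<in> ereal ` I \<union> {\<infinity>}"
      using k(1) k'(1) V'(1) by (intro mem) auto
    then obtain d where "m $$ (i, j) = ereal d" "d \<le> c"
      using c by auto
    then show "s' j - s' i \<le> c"
      using bound[OF ij] by force
  qed (rule s'_bar)
  then show ?thesis
    using that x(1) unfolding s'_def by blast
qed

text \<open>Variables are added in increasing order; one whose indices already belong to the set is
  skipped, so the prescribed values survive.\<close>

lemma extend_feasible:
  assumes m: "dbm I (2 * N) m" and closed: "strongly_closed N m" and t: "feasible {..<2 * N} m t"
    and V: "V \<subseteq> {..<2 * N}" "bar ` V \<subseteq> V"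
    and s: "feasible V m s" "\<And>i. s i \<in> I"
  obtains s' where "\<And>i. i \<in> V \<Longrightarrow> s' i = s i" "\<And>i. s' i \<in> I" "feasible {..<2 * N} m s'"
proof -
  have "\<exists>s'. (\<forall>i\<in>V. s' i = s i) \<and> (\<forall>i. s' i \<in> I) \<and> feasible (V \<union> {..<2 * u}) m s'" if "u \<le> N" for u
    using that
  proof (induction u)
    case 0
    then show ?case
      using s by auto
  next
    case (Suc u)
    let ?W = "V \<union> {..<2 * u}"
    from Suc obtain s' where s': "\<And>i. i \<in> V \<Longrightarrow> s' i = s i" "\<And>i. s' i \<in> I" "feasible ?W m s'"
      by auto
    have W: "?W \<subseteq> {..<2 * N}" "bar ` ?W \<subseteq> ?W" and u: "2 * u < 2 * N"
      using V Suc.prems by auto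
    have eq: "V \<union> {..<2 * Suc u} = insert (2 * u) (insert (bar (2 * u)) ?W)"
      by (auto simp: bar_even)
    show ?case
    proof (cases "2 * u \<in> ?W")
      case True
      then have "V \<union> {..<2 * Suc u} = ?W"
        unfolding eq using W(2) by blast
      then show ?thesis
        using s' by auto
    next
      case False
      then have "bar (2 * u) \<notin> ?W"
        using W(2) by (metis bar_bar image_subset_iff)
      moreover obtain x where "x \<in> I" "feasible (V \<union> {..<2 * Suc u}) m (s'(2 * u := x, bar (2 * u) := - x))"
        using extend_feasible_one[OF m closed t W u False s'(3,2)] unfolding eq by blast
      ultimately show ?thesis
        using False s'(1,2) uminus_mem
        by (intro exI[of _ "s'(2 * u := x, bar (2 * u) := - x)"] conjI) (auto simp: fun_upd_def)
    qed
  qed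
  from this[OF order_refl] show ?thesis
    using that V(1) by (auto simp: Un_absorb1)
qed

text \<open>Starting point of the extension, and the place where strength enters: with the
  difference fixed, one degree of freedom remains, and its upper and lower bounds must be
  compatible.\<close>

lemma feasible_pair:
  assumes m: "dbm I (2 * N) m" and closed: "strongly_closed N m" and t: "feasible {..<2 * N} m t"
    and ij: "i < 2 * N" "j < 2 * N" "i \<noteq> j"
    and c: "c \<in> I" "ereal c \<le> m $$ (i, j)" "ereal (- c) \<le> m $$ (j, i)"
  obtains s where "s j - s i = c" "\<And>q. s q \<in> I" "feasible {i, bar i, j, bar j} m s"
proof -
  have car: "m \<in> carrier_mat (2 * N) (2 * N)" and dim: "dim_row m = 2 * N"
    using m by (auto simp: dbm_def)
  have mem: "m $$ (i, j) \<in> ereal ` I \<union> {\<infinity>}" if "i < 2 * N" "j < 2 * N" for i j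
    using m that by (simp add: dbm_def)
  have tri: "m $$ (i, j) \<le> ereal (a + b)"
    if "m $$ (i, p) = ereal a" "m $$ (p, j) = ereal b" "i < 2 * N" "j < 2 * N" "p < 2 * N" for i j p a b
    using closed_atD[of m p i j a b] closed that by (simp add: strongly_closed_def dim)
  have coh: "m $$ (i, j) = m $$ (bar j, bar i)" if "i < 2 * N" "j < 2 * N" for i j
    using closed coherentD[OF _ car that] by (simp add: strongly_closed_def)
  have strong: "m $$ (i, j) \<le> ereal ((a + b) / 2)"
    if "m $$ (i, bar i) = ereal a" "m $$ (bar j, j) = ereal b" "i < 2 * N" "j < 2 * N" for i j a b
    using closed that by (simp add: strongly_closed_def)
  have diag: "0 \<le> d" if "m $$ (i, i) \<le> ereal d" "i < 2 * N" for i d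
    using feasible_bound[OF t that(1)] that(2) by simp
  have bars: "bar i < 2 * N" "bar j < 2 * N"
    using ij by auto
  have upper: "c \<le> d" if "m $$ (i, j) \<le> ereal d" for d
    using order_trans[OF c(2) that] by simp
  have lower: "- c \<le> d" if "m $$ (j, i) \<le> ereal d" for d
    using order_trans[OF c(3) that] by simp
  have upper': "c \<le> d" if "m $$ (bar j, bar i) \<le> ereal d" for d
    using upper that coh[OF ij(1,2)] by simp
  have lower': "- c \<le> d" if "m $$ (bar i, bar j) \<le> ereal d" for d
    using lower that coh[OF ij(2,1)] by simp
  show ?thesis
  proof (cases "j = bar i")
    case True
    \<comment> \<open>Both indices belong to one variable, so the difference is twice
      \<open>s j\<close> and determines it.\<close>
    define s where "s = (\<lambda>_. 0)(i := - c / 2, j := c / 2)"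
    have "feasible {i, bar i, j, bar j} m s"
    proof (rule feasibleI)
      fix p q d assume "p \<in> {i, bar i, j, bar j}" "q \<in> {i, bar i, j, bar j}" and d: "m $$ (p, q) \<le> ereal d"
      then consider "p = q" "p < 2 * N" | "p = i" "q = j" | "p = j" "q = i"
        using True ij by auto
      then show "s q - s p \<le> d"
        using d diag upper lower True by cases (auto simp: s_def)
    qed (auto simp: s_def True bar_swap)
    moreover have "s q \<in> I" for q
      using half_mem[OF c(1)] half_mem[OF uminus_mem[OF c(1)]] zero_mem by (simp add: s_def)
    ultimately show ?thesis
      using that[of s] ij(3) by (simp add: s_def True)
  next
    case False
    \<comment> \<open>The unknown is \<open>x = 2 * s i\<close> with \<open>s j = s i + c\<close>;
      doubling makes all its coefficients \<open>1\<close> or \<open>- 1\<close>. \<open>A\<close>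
      bounds \<open>x\<close> and \<open>B\<close> bounds \<open>- x\<close>.\<close>
    define A where "A = {m $$ (bar i, i), ereal (- (c + c)) + m $$ (bar j, j), ereal (- c) + m $$ (bar i, j)}"
    define B where "B = {m $$ (i, bar i), ereal (c + c) + m $$ (j, bar j), ereal c + m $$ (i, bar j)}"
    have shift: "y = ereal (a - d)" if "ereal a = ereal d + y" for a d and y :: ereal
      using that by (cases y) auto
    have A_cases: "m $$ (bar i, i) = ereal a \<or> m $$ (bar j, j) = ereal (a + 2 * c) \<or>
        m $$ (bar i, j) = ereal (a + c)" if "ereal a \<in> A" for a
      using that shift[of a "- (c + c)" "m $$ (bar j, j)"] shift[of a "- c" "m $$ (bar i, j)"]
      by (auto simp: A_def)
    have B_cases: "m $$ (i, bar i) = ereal b \<or> m $$ (j, bar j) = ereal (b - 2 * c) \<or>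
        m $$ (i, bar j) = ereal (b - c)" if "ereal b \<in> B" for b
      using that shift[of b "c + c" "m $$ (j, bar j)"] shift[of b c "m $$ (i, bar j)"]
      by (auto simp: B_def)
    have "finite A" "finite B"
      by (auto simp: A_def B_def)
    moreover have "A \<subseteq> ereal ` I \<union> {\<infinity>}" "B \<subseteq> ereal ` I \<union> {\<infinity>}"
      unfolding A_def B_def insert_subset using ij bars c(1)
      by (simp_all only: mem ereal_add_mem uminus_mem add_mem empty_subsetI simp_thms)
    moreover have "0 \<le> a + b" if ab: "ereal a \<in> A" "ereal b \<in> B" for a b
      using A_cases[OF ab(1)] B_cases[OF ab(2)]
    proof (elim disjE)
      assume "m $$ (bar i, i) = ereal a" "m $$ (i, bar i) = ereal b"
      then show ?thesis
        using diag[OF tri] ij bars by blast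
    next
      \<comment> \<open>These edges share no index, so the triangle inequality cannot join them;
        strength combines them into a bound on the entry at \<open>(j, i)\<close>.\<close>
      assume "m $$ (bar i, i) = ereal a" "m $$ (j, bar j) = ereal (b - 2 * c)"
      then show ?thesis
        using lower[OF strong[of j "b - 2 * c" i a]] ij by simp
    next
      assume "m $$ (bar i, i) = ereal a" "m $$ (i, bar j) = ereal (b - c)"
      then show ?thesis
        using lower'[OF tri] ij bars by fastforce
    next
      assume "m $$ (bar j, j) = ereal (a + 2 * c)" "m $$ (i, bar i) = ereal b"
      then show ?thesis
        using upper[OF strong[of i b j "a + 2 * c"]] ij by simp
    next
      assume "m $$ (bar j, j) = ereal (a + 2 * c)" "m $$ (j, bar j) = ereal (b - 2 * c)"
      then show ?thesis
        using diag[OF tri] ij bars by fastforce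
    next
      assume "m $$ (bar j, j) = ereal (a + 2 * c)" "m $$ (i, bar j) = ereal (b - c)"
      then show ?thesis
        using upper[OF tri] ij bars by fastforce
    next
      assume "m $$ (bar i, j) = ereal (a + c)" "m $$ (i, bar i) = ereal b"
      then show ?thesis
        using upper[OF tri] ij bars by fastforce
    next
      assume "m $$ (bar i, j) = ereal (a + c)" "m $$ (j, bar j) = ereal (b - 2 * c)"
      then show ?thesis
        using lower'[OF tri] ij bars by fastforce
    next
      \<comment> \<open>Coherence turns the two edges into a cycle between \<open>i\<close> and
        \<open>bar j\<close>.\<close>
      assume *: "m $$ (bar i, j) = ereal (a + c)" "m $$ (i, bar j) = ereal (b - c)"
      then have "m $$ (bar j, i) = ereal (a + c)"
        using coh[of "bar i" j] ij bars by simp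
      with *(2) show ?thesis
        using diag[OF tri] ij bars by fastforce
    qed
    ultimately obtain x where x: "x \<in> I" "\<And>d. ereal d \<in> A \<Longrightarrow> x \<le> d" "\<And>d. ereal d \<in> B \<Longrightarrow> - x \<le> d"
      using exists_between_bounds by blast
    define s where
      "s = (\<lambda>_. 0)(i := x / 2, bar i := - (x / 2), j := x / 2 + c, bar j := - (x / 2 + c))"
    have distinct: "i \<noteq> j" "i \<noteq> bar j" "bar i \<noteq> j" "j \<noteq> i" "bar j \<noteq> i" "j \<noteq> bar i"
      using ij(3) False by (auto simp: bar_swap)
    have val: "s i = x / 2" "s (bar i) = - (x / 2)" "s j = x / 2 + c" "s (bar j) = - (x / 2 + c)"
      using distinct by (auto simp: s_def)
    have A: "x \<le> d" if "m $$ (bar i, i) = ereal d" for d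
      using x(2)[of d] that by (simp add: A_def)
    have A': "x \<le> d - 2 * c" if "m $$ (bar j, j) = ereal d" for d
      using x(2)[of "d - 2 * c"] that by (simp add: A_def)
    have A'': "x \<le> d - c" if "m $$ (bar i, j) = ereal d" for d
      using x(2)[of "d - c"] that by (simp add: A_def)
    have B: "- x \<le> d" if "m $$ (i, bar i) = ereal d" for d
      using x(3)[of d] that by (simp add: B_def)
    have B': "- x \<le> d + 2 * c" if "m $$ (j, bar j) = ereal d" for d
      using x(3)[of "d + 2 * c"] that by (simp add: B_def)
    have B'': "- x \<le> d + c" if "m $$ (i, bar j) = ereal d" for d
      using x(3)[of "d + c"] that by (simp add: B_def)
    have bound: "s q - s p \<le> d" if pq: "p \<in> {i, bar i, j, bar j}" "q \<in> {i, bar i, j, bar j}"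
      and d: "m $$ (p, q) = ereal d" for p q d
    proof -
      have "s q - s p \<le> d" if "p = q"
        using diag[of p d] d pq(1) ij bars that by auto
      moreover have "s q - s p \<le> d" if "p = i" "q \<in> {bar i, j, bar j}"
        using that d B upper[of d] B'' by (auto simp: val)
      moreover have "s q - s p \<le> d" if "p = bar i" "q \<in> {i, j, bar j}"
        using that d A lower'[of d] A'' by (auto simp: val)
      moreover have "s q - s p \<le> d" if "p = j" "q \<in> {i, bar i, bar j}"
        using that d B' lower[of d] B'' coh[of j "bar i"] ij bars by (auto simp: val)
      moreover have "s q - s p \<le> d" if "p = bar j" "q \<in> {i, bar i, j}"
        using that d A' upper'[of d] A'' coh[of "bar j" i] ij bars by (auto simp: val)
      ultimately show ?thesis
        using pq by blast
    qed
    have "feasible {i, bar i, j, bar j} m s"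
    proof (rule feasibleI)
      fix p q d
      assume pq: "p \<in> {i, bar i, j, bar j}" "q \<in> {i, bar i, j, bar j}" and d: "m $$ (p, q) \<le> ereal d"
      then have "m $$ (p, q) \<in> ereal ` I \<union> {\<infinity>}"
        using ij bars by (intro mem) auto
      then obtain d' where "m $$ (p, q) = ereal d'" "d' \<le> d"
        using d by auto
      then show "s q - s p \<le> d"
        using bound[OF pq] by force
    next
      fix q
      show "s (bar q) = - s q"
      proof (cases "q \<in> {i, bar i, j, bar j}")
        case True
        then show ?thesis
          by (auto simp: val)
      next
        case False
        then have "bar q \<notin> {i, bar i, j, bar j}"
          by (auto simp: bar_swap)
        with False show ?thesis
          by (simp add: s_def)
      qed
    qed
    moreover have "s q \<in> I" for q
      using half_mem[OF x(1)] add_mem[OF half_mem[OF x(1)] c(1)] zero_mem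
        uminus_mem[OF half_mem[OF x(1)]] uminus_mem[OF add_mem[OF half_mem[OF x(1)] c(1)]]
      by (simp add: s_def)
    ultimately show ?thesis
      using that[of s] val by simp
  qed
qed

text \<open>Every scalar compatible with the two opposite entries is attained as a difference: the
  pair of variables is solved first and the solution is then extended to all the others.\<close>

lemma tight_point:
  assumes m: "dbm I (2 * N) m" and closed: "strongly_closed N m" and t: "feasible {..<2 * N} m t"
    and ij: "i < 2 * N" "j < 2 * N" "i \<noteq> j"
    and c: "c \<in> I" "ereal c \<le> m $$ (i, j)" "ereal (- c) \<le> m $$ (j, i)"
  obtains v where "v \<in> oct_domain I m" "signed v j - signed v i = c"
proof -
  obtain s0 where s0: "s0 j - s0 i = c" "\<And>q. s0 q \<in> I" "feasible {i, bar i, j, bar j} m s0"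
    using feasible_pair[OF assms] by blast
  have "{i, bar i, j, bar j} \<subseteq> {..<2 * N}" "bar ` {i, bar i, j, bar j} \<subseteq> {i, bar i, j, bar j}"
    using ij by auto
  from extend_feasible[OF m closed t this s0(3,2)] obtain s
    where s: "\<And>q. q \<in> {i, bar i, j, bar j} \<Longrightarrow> s q = s0 q" "\<And>q. s q \<in> I" "feasible {..<2 * N} m s"
    by blast
  define v where "v = vec N (\<lambda>q. s (2 * q))"
  have signed: "signed v q = s q" if "q < 2 * N" for q
  proof (cases "even q")
    case True
    then show ?thesis
      using that by (auto simp: signed_def v_def)
  next
    case False
    then obtain k where q: "q = 2 * k + 1"
      by (rule oddE)
    have "s q = - s (2 * (q div 2))"
      using feasible_bar[OF s(3), of "2 * k"] by (simp add: q bar_even)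
    then show ?thesis
      using that False by (auto simp: signed_def v_def)
  qed
  have "feasible {..<2 * N} m (signed v)"
    using s(3) by (simp add: feasible_def signed_bar signed)
  then have "v \<in> oct_domain I m"
    using m s(2) by (subst oct_domain_iff[of m N]) (auto simp: dbm_def v_def)
  moreover have "signed v j - signed v i = c"
    using s(1) s0(1) signed ij by simp
  ultimately show ?thesis
    using that by blast
qed

section \<open>Comparison of matrices through their domains\<close>

lemma oct_domain_strong_closure:
  assumes m: "dbm I (2 * N) m" "coherent m" "N \<ge> 1" and t: "feasible {..<2 * N} m t"
  shows "oct_domain I (strong_closure m) = oct_domain I m"
proof -
  have "dim_row (strong_closure m) = 2 * N" "dim_row m = 2 * N"
    using dbm_strong_closure[OF m(1,2) t m(3)] m(1) by (auto simp: dbm_def)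
  then show ?thesis
    using feasible_strong_closure_iff[OF m(1,2) t m(3)] by (auto simp: oct_domain_iff)
qed

text \<open>Off the diagonal an entry of \<open>m\<close> is the supremum of the corresponding
  difference over the domain, so every matrix bounding the domain dominates it. On the diagonal
  \<open>m\<close> is at most \<open>0\<close>, which bounds \<open>n\<close> from below.\<close>

lemma strongly_closed_le_if_oct_domain_subset:
  assumes m: "dbm I (2 * N) m" and closed: "strongly_closed N m" and n: "dbm I (2 * N) n"
    and ne: "oct_domain I m \<noteq> {}" and sub: "oct_domain I m \<subseteq> oct_domain I n"
  shows "m \<le> n"
proof -
  have dim: "dim_row m = 2 * N" "dim_row n = 2 * N" "dim_col m = 2 * N" "dim_col n = 2 * N"
    using m n by (auto simp: dbm_def)
  obtain u where u: "u \<in> oct_domain I m"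
    using ne by blast
  note t = oct_domain_iff[OF dim(1), THEN iffD1, OF u, THEN conjunct2, THEN conjunct2]
  have n_bound: "signed v j - signed v i \<le> d"
    if "v \<in> oct_domain I m" "n $$ (i, j) \<le> ereal d" "i < 2 * N" "j < 2 * N" for v i j d
    using feasible_bound[of "{..<2 * N}" n "signed v"] that sub oct_domain_iff[OF dim(2), of v] by auto
  have "m $$ (i, j) \<le> n $$ (i, j)" if ij: "i < 2 * N" "j < 2 * N" for i j
  proof (rule ereal_le_by_bounds)
    fix d assume d: "n $$ (i, j) \<le> ereal d"
    show "m $$ (i, j) \<le> ereal d"
    proof (cases "i = j")
      case True
      then have "0 \<le> d"
        using n_bound[OF u d ij] by simp
      moreover have "m $$ (i, i) \<le> 0"
        using closed ij by (simp add: strongly_closed_def)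
      ultimately show ?thesis
        using True by (metis ereal_less_eq(5) order_trans)
    next
      case False
      have tight: "c \<le> d" if "c \<in> I" "ereal c \<le> m $$ (i, j)" "ereal (- c) \<le> m $$ (j, i)" for c
        using tight_point[OF m closed t ij False that] n_bound[OF _ d ij] by metis
      have cycle: "- c \<le> e" if "m $$ (i, j) = ereal c" "m $$ (j, i) = ereal e" for c e
        using feasible_bound[OF t, of i j c] feasible_bound[OF t, of j i e] that ij by simp
      have mem: "m $$ (i, j) \<in> ereal ` I \<union> {\<infinity>}" "m $$ (j, i) \<in> ereal ` I \<union> {\<infinity>}"
        using m ij by (auto simp: dbm_def)
      show ?thesis
      proof (cases "m $$ (i, j)")
        case (real c)
        \<comment> \<open>A finite entry is its own witness: the cycle through \<open>i\<close> and
          \<open>j\<close> being non-negative makes it compatible with the opposite entry.\<close>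
        then have "c \<in> I" "ereal (- c) \<le> m $$ (j, i)"
          using mem cycle[of c] by auto
        then show ?thesis
          using tight real by simp
      next
        case PInf
        \<comment> \<open>For an infinite entry some natural number beyond \<open>d\<close> is
          attained, a contradiction; it must also exceed \<open>e\<close> to respect the opposite
          entry.\<close>
        obtain e where e: "ereal (- e) \<le> m $$ (j, i)"
        proof (cases "m $$ (j, i)")
          case (real r)
          then show ?thesis
            using that[of "- r"] by simp
        next
          case PInf
          then show ?thesis
            using that[of 0] by simp
        qed (use mem in auto)
        obtain q :: nat where q: "max e (d + 1) \<le> of_nat q"
          using real_arch_simple by blast
        then have "ereal (- of_nat q) \<le> m $$ (j, i)"
          using e by (intro order_trans[OF _ e]) simp
        then show ?thesis
          using tight[OF of_nat_mem, of q] PInf q by simp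
      qed (use mem in auto)
    qed
  qed
  then show ?thesis
    by (simp add: less_eq_mat_def dim)
qed

lemma oct_domain_mono:
  assumes "dim_row m = 2 * N" "dim_row n = 2 * N" "dim_col n = 2 * N" "m \<le> n"
  shows "oct_domain I m \<subseteq> oct_domain I n"
proof -
  have "m $$ (i, j) \<le> n $$ (i, j)" if "i < 2 * N" "j < 2 * N" for i j
    using assms that by (simp add: less_eq_mat_def)
  then have "feasible {..<2 * N} n s" if "feasible {..<2 * N} m s" for s
    using that unfolding feasible_def by (meson lessThan_iff order_trans)
  then show ?thesis
    using oct_domain_iff[OF assms(1)] oct_domain_iff[OF assms(2)] by blast
qed

end

theorem theorem5:
  fixes I :: "real set" and N :: nat and m n :: "ereal mat"
  assumes "I \<in> {\<rat>, UNIV}"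
    and "N \<ge> 1"
    and "dbm I (2 * N) m" and "coherent m"
    and "dbm I (2 * N) n" and "coherent n"
    and "oct_domain I m \<noteq> {}" and "oct_domain I n \<noteq> {}"
  shows "(oct_domain I m \<subseteq> oct_domain I n \<longleftrightarrow> strong_closure m \<le> n) \<and>
         (oct_domain I m = oct_domain I n \<longleftrightarrow> strong_closure m = strong_closure n)"
proof -
  interpret scalar_set I
    using assms(1) by unfold_locales auto
  have dim: "dim_row m = 2 * N" "dim_row n = 2 * N" "dim_col n = 2 * N"
    using assms(3,5) by (auto simp: dbm_def)
  \<comment> \<open>Non-emptiness supplies the points that exclude negative cycles in
    \<open>m\<close> and \<open>n\<close>.\<close>
  obtain s t where s: "feasible {..<2 * N} m s" and t: "feasible {..<2 * N} n t"
    using assms(7,8) oct_domain_iff[OF dim(1)] oct_domain_iff[OF dim(2)] by blast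
  note dbm = dbm_strong_closure[OF assms(3,4) s assms(2)] dbm_strong_closure[OF assms(5,6) t assms(2)]
  note closed = strongly_closed_strong_closure[OF assms(3,4) s assms(2)]
    strongly_closed_strong_closure[OF assms(5,6) t assms(2)]
  note dom = oct_domain_strong_closure[OF assms(3,4,2) s] oct_domain_strong_closure[OF assms(5,6,2) t]
  have dim': "dim_row (strong_closure m) = 2 * N"
    using dbm(1) by (auto simp: dbm_def)
  note le = strongly_closed_le_if_oct_domain_subset
  show ?thesis
  proof (intro conjI iffI)
    assume "oct_domain I m \<subseteq> oct_domain I n"
    then show "strong_closure m \<le> n"
      using le[OF dbm(1) closed(1) assms(5)] dom(1) assms(7) by simp
  next
    assume "strong_closure m \<le> n"
    then show "oct_domain I m \<subseteq> oct_domain I n"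
      using oct_domain_mono[OF dim' dim(2,3)] dom(1) by simp
  next
    assume "oct_domain I m = oct_domain I n"
    \<comment> \<open>Each closure lies below every matrix with the same domain, in particular below
      the other closure.\<close>
    then show "strong_closure m = strong_closure n"
      using le[OF dbm(1) closed(1) dbm(2)] le[OF dbm(2) closed(2) dbm(1)] dom assms(7,8)
      by (simp add: antisym)
  next
    assume "strong_closure m = strong_closure n"
    then show "oct_domain I m = oct_domain I n"
      using dom by simp
  qed
qed

end
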